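(* Fix $\beta>0$. For $\epsilon\ge0$ let $T_\epsilon:[0,1]\to[0,1]$, $T_\epsilon y=2y+\epsilon^\beta\bmod 1$. For $y_0\in[0,1]$ and $\epsilon>0$ define $x^{(\epsilon)}_0=0$, $y^{(\epsilon)}_0=y_0$ and $$x^{(\epsilon)}_{n+1}=x^{(\epsilon)}_n+\epsilon\cos(2\pi y^{(\epsilon)}_n),\qquad y^{(\epsilon)}_{n+1}=T_\epsilon y^{(\epsilon)}_n,\qquad n\ge0,$$ and let $\hat x^{(\epsilon)}(t)=x^{(\epsilon)}_{[t/\epsilon]}$ for $t\in[0,1]$. Then for every $y_0\in[0,1]$, $$\limsup_{\epsilon\to0}\hat x^{(\epsilon)}(1)=1.$$
   Context: Here $[\cdot]$ denotes the integer part, and $\epsilon\to0$ through positive reals. *)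

theory Defs
  imports Complex_Main "HOL-Library.Extended_Real"
begin

(* Values are representatives in [0,1) of the class modulo 1, so the map sends [0,1] into itself
   (the endpoint 1 is admitted as an initial point).  At \<epsilon> = 0 the shift vanishes for \<beta> > 0,
   since 0 powr \<beta> = 0, and it is the doubling map. *)
definition fast_map :: "real \<Rightarrow> real \<Rightarrow> real \<Rightarrow> real" where
  "fast_map \<beta> \<epsilon> y = frac (2 * y + \<epsilon> powr \<beta>)"

primrec fast_var :: "real \<Rightarrow> real \<Rightarrow> real \<Rightarrow> nat \<Rightarrow> real" where
  "fast_var \<beta> \<epsilon> y0 0 = y0"
| "fast_var \<beta> \<epsilon> y0 (Suc n) = fast_map \<beta> \<epsilon> (fast_var \<beta> \<epsilon> y0 n)"

primrec slow_var :: "real \<Rightarrow> real \<Rightarrow> real \<Rightarrow> nat \<Rightarrow> real" where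
  "slow_var \<beta> \<epsilon> y0 0 = 0"
| "slow_var \<beta> \<epsilon> y0 (Suc n) =
     slow_var \<beta> \<epsilon> y0 n + \<epsilon> * cos (2 * pi * fast_var \<beta> \<epsilon> y0 n)"

(* Meant for \<epsilon> > 0 and 0 \<le> t \<le> 1, where the floor is nonnegative. *)
definition slow_path :: "real \<Rightarrow> real \<Rightarrow> real \<Rightarrow> real \<Rightarrow> real" where
  "slow_path \<beta> \<epsilon> y0 t = slow_var \<beta> \<epsilon> y0 (nat \<lfloor>t / \<epsilon>\<rfloor>)"

end

theory Submission imports Defs begin

text \<open>
  Write \<open>a = \<epsilon> powr \<beta>\<close>. The translation \<open>z = y + a\<close> conjugates the fast map to the doubling map, so
  \<open>y\<^sub>n\<close> is \<open>2 ^ n * (y0 + a) - a\<close> modulo 1. The slow variable at time 1 is at most \<open>\<epsilon> * nat \<lfloor>1 / \<epsilon>\<rfloor> \<le> 1\<close>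
  for every \<open>\<epsilon> > 0\<close>, so the limsup is at most 1. The value 1 is approached along parameters for which \<open>y0 + a\<close> is a
  dyadic rational: if \<open>2 ^ m * (y0 + a)\<close> is an integer, then from time \<open>m\<close> on the fast variable sits
  (modulo 1) at the fixed point \<open>- a\<close> of the fast map, where the increment is \<open>\<epsilon> * cos (2 * pi * a)\<close>, close to \<open>\<epsilon>\<close>.

  Such \<open>a\<close> can be found in \<open>(0, (1/2) ^ m]\<close>, which gives \<open>\<epsilon> \<le> ((1/2) powr (1 / \<beta>)) ^ m\<close>. The \<open>m\<close> initial
  steps therefore contribute \<open>O(\<epsilon> * m)\<close>, which is negligible whatever the value of \<open>\<beta>\<close>, because \<open>m\<close>
  is only logarithmic in \<open>1 / \<epsilon>\<close>.
\<close>

text \<open>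
  Adding \<open>\<epsilon> powr \<beta>\<close> to the fast variable turns the affine recursion into pure doubling; the integer parts
  removed along the way are doubled too, so they stay integers.
\<close>
lemma fast_var_eq_doubling:
  "\<exists>k::int. fast_var \<beta> \<epsilon> y0 n = 2 ^ n * (y0 + \<epsilon> powr \<beta>) - \<epsilon> powr \<beta> - of_int k"
proof (induction n)
  case 0
  show ?case by (intro exI[of _ 0]) simp
next
  case (Suc n)
  then obtain k :: int where
    k: "fast_var \<beta> \<epsilon> y0 n = 2 ^ n * (y0 + \<epsilon> powr \<beta>) - \<epsilon> powr \<beta> - of_int k" by blast
  show ?case
    by (intro exI[of _ "2 * k + \<lfloor>2 * fast_var \<beta> \<epsilon> y0 n + \<epsilon> powr \<beta>\<rfloor>"])
       (simp add: fast_map_def frac_def k algebra_simps)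
qed

text \<open>
  Once \<open>2 ^ m * (y0 + \<epsilon> powr \<beta>)\<close> is an integer, doubling keeps it one, so the fast variable equals
  \<open>- \<epsilon> powr \<beta>\<close> modulo 1 from time \<open>m\<close> on.
\<close>
lemma cos_fast_var_eq_if_dyadic:
  assumes "2 ^ m * (y0 + \<epsilon> powr \<beta>) \<in> \<int>" and "m \<le> n"
  shows "cos (2 * pi * fast_var \<beta> \<epsilon> y0 n) = cos (2 * pi * \<epsilon> powr \<beta>)"
proof -
  obtain k :: int where
    k: "fast_var \<beta> \<epsilon> y0 n = 2 ^ n * (y0 + \<epsilon> powr \<beta>) - \<epsilon> powr \<beta> - of_int k"
    using fast_var_eq_doubling by blast
  have "2 ^ n * (y0 + \<epsilon> powr \<beta>) = 2 ^ (n - m) * (2 ^ m * (y0 + \<epsilon> powr \<beta>))"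
    using \<open>m \<le> n\<close> by (simp flip: power_add)
  moreover have "\<dots> \<in> \<int>"
    by (rule Ints_mult[OF _ assms(1)]) simp
  ultimately obtain i :: int where "2 ^ n * (y0 + \<epsilon> powr \<beta>) = of_int i"
    by (auto elim: Ints_cases)
  then have "2 * pi * fast_var \<beta> \<epsilon> y0 n = 2 * pi * of_int (i - k) - 2 * pi * \<epsilon> powr \<beta>"
    by (simp add: k algebra_simps)
  then show ?thesis
    by (simp only: cos_diff cos_int_2pin sin_int_2pin)
qed

lemma slow_var_le: "\<epsilon> \<ge> 0 \<Longrightarrow> slow_var \<beta> \<epsilon> y0 n \<le> \<epsilon> * real n"
proof (induction n)
  case (Suc n)
  have "\<epsilon> * cos (2 * pi * fast_var \<beta> \<epsilon> y0 n) \<le> \<epsilon> * 1"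
    using Suc.prems by (intro mult_left_mono) auto
  with Suc show ?case by (simp add: algebra_simps)
qed simp

lemma slow_var_ge_if_eventually_cos_ge:
  assumes "\<epsilon> \<ge> 0" and "c \<le> 1"
    and "\<And>n. m \<le> n \<Longrightarrow> c \<le> cos (2 * pi * fast_var \<beta> \<epsilon> y0 n)"
  shows "\<epsilon> * (c * real n - 2 * real m) \<le> slow_var \<beta> \<epsilon> y0 n"
proof -
  \<comment> \<open>Each of the first \<open>m\<close> increments loses at most \<open>2 * \<epsilon>\<close> against \<open>\<epsilon> * c\<close>, since \<open>-1 \<ge> c - 2\<close>.\<close>
  have "\<epsilon> * (c * real n - 2 * real (min n m)) \<le> slow_var \<beta> \<epsilon> y0 n"
  proof (induction n)
    case (Suc n)
    have "c - 2 * real (min (Suc n) m) + 2 * real (min n m) \<le> cos (2 * pi * fast_var \<beta> \<epsilon> y0 n)"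
    proof (cases "m \<le> n")
      case True
      with assms(3) show ?thesis by simp
    next
      case False
      then show ?thesis
        using assms(2) cos_ge_minus_one[of "2 * pi * fast_var \<beta> \<epsilon> y0 n"]
        by (simp del: cos_ge_minus_one)
    qed
    from mult_left_mono[OF this assms(1)] Suc show ?case
      by (simp add: algebra_simps)
  qed simp
  moreover have "\<epsilon> * (c * real n - 2 * real m) \<le> \<epsilon> * (c * real n - 2 * real (min n m))"
    using assms(1) by (intro mult_left_mono) auto
  ultimately show ?thesis by linarith
qed

lemma slow_path_le_1:
  assumes "\<epsilon> > 0"
  shows "slow_path \<beta> \<epsilon> y0 1 \<le> 1"
proof -
  have "real (nat \<lfloor>1 / \<epsilon>\<rfloor>) \<le> 1 / \<epsilon>" using assms by simp
  then have "\<epsilon> * real (nat \<lfloor>1 / \<epsilon>\<rfloor>) \<le> \<epsilon> * (1 / \<epsilon>)"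
    using assms by (intro mult_left_mono) auto
  with slow_var_le[of \<epsilon> \<beta> y0 "nat \<lfloor>1 / \<epsilon>\<rfloor>"] assms show ?thesis
    by (simp add: slow_path_def)
qed

lemma step_times_number_of_steps_tendsto_1:
  "((\<lambda>\<epsilon>::real. \<epsilon> * real (nat \<lfloor>1 / \<epsilon>\<rfloor>)) \<longlongrightarrow> 1) (at_right 0)"
proof (rule tendsto_sandwich)
  show "\<forall>\<^sub>F \<epsilon> in at_right 0. 1 - \<epsilon> \<le> \<epsilon> * real (nat \<lfloor>1 / \<epsilon>\<rfloor>)"
    using eventually_at_right_less[of 0]
  proof eventually_elim
    case (elim \<epsilon>)
    have "1 / \<epsilon> - 1 \<le> real (nat \<lfloor>1 / \<epsilon>\<rfloor>)" by linarith
    then have "\<epsilon> * (1 / \<epsilon> - 1) \<le> \<epsilon> * real (nat \<lfloor>1 / \<epsilon>\<rfloor>)"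
      using elim by (intro mult_left_mono) auto
    with elim show ?case by (simp add: algebra_simps)
  qed
  show "\<forall>\<^sub>F \<epsilon> in at_right 0. \<epsilon> * real (nat \<lfloor>1 / \<epsilon>\<rfloor>) \<le> 1"
    using eventually_at_right_less[of 0]
  proof eventually_elim
    case (elim \<epsilon>)
    have "real (nat \<lfloor>1 / \<epsilon>\<rfloor>) \<le> 1 / \<epsilon>" using elim by simp
    then have "\<epsilon> * real (nat \<lfloor>1 / \<epsilon>\<rfloor>) \<le> \<epsilon> * (1 / \<epsilon>)"
      using elim by (intro mult_left_mono) auto
    with elim show ?case by simp
  qed
  show "((\<lambda>\<epsilon>::real. 1 - \<epsilon>) \<longlongrightarrow> 1) (at_right 0)"
    by (auto intro!: tendsto_eq_intros)
qed simp

text \<open>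
  Rounding \<open>y\<close> up to a multiple of \<open>(1/2) ^ m\<close>, with \<open>floor + 1\<close> rather than the ceiling, keeps the shift
  strictly positive even when \<open>y\<close> is itself dyadic. Positivity is what makes it \<open>\<epsilon> powr \<beta>\<close> for some \<open>\<epsilon> > 0\<close>.
\<close>
lemma exists_dyadic_shift:
  fixes y :: real
  shows "\<exists>a>0. a \<le> (1/2) ^ m \<and> 2 ^ m * (y + a) \<in> \<int>"
proof (intro exI conjI)
  let ?a = "(of_int (\<lfloor>2 ^ m * y\<rfloor> + 1) - 2 ^ m * y) / 2 ^ m"
  show "0 < ?a" by (intro divide_pos_pos) (linarith, simp)
  have "?a \<le> 1 / 2 ^ m" by (intro divide_right_mono) (linarith, simp)
  then show "?a \<le> (1/2) ^ m" by (simp add: power_divide)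
  have "2 ^ m * (y + ?a) = of_int (\<lfloor>2 ^ m * y\<rfloor> + 1)" by (simp add: field_simps)
  then show "2 ^ m * (y + ?a) \<in> \<int>" by (metis Ints_of_int)
qed

text \<open>
  The dyadic shifts \<open>a m\<close> are at most \<open>(1/2) ^ m\<close>, so \<open>e m = a m powr (1 / \<beta>)\<close> decays geometrically. Hence the cost
  \<open>2 * m * e m\<close> of the first \<open>m\<close> steps vanishes, while the increments after them have cosine
  \<open>cos (2 * pi * a m)\<close>, which tends to 1.
\<close>
lemma slow_path_tendsto_1_along_dyadic_shifts:
  assumes "\<beta> > 0"
  shows "\<exists>e. filterlim e (at_right 0) sequentially \<and>
             (\<lambda>m. slow_path \<beta> (e m) y0 1) \<longlonglongrightarrow> 1"
proof -
  obtain a where a: "\<And>m. a m > 0" "\<And>m. a m \<le> (1/2) ^ m" "\<And>m. 2 ^ m * (y0 + a m) \<in> \<int>"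
    using exists_dyadic_shift[of _ y0] by metis
  define e where "e m = a m powr (1 / \<beta>)" for m
  have e_pos: "e m > 0" for m
    using a(1)[of m] by (simp add: e_def)
  have e_powr: "e m powr \<beta> = a m" for m
    using a(1)[of m] assms by (simp add: e_def powr_powr)
  define q :: real where "q = (1/2) powr (1 / \<beta>)"
  have "q < 1 powr (1 / \<beta>)"
    unfolding q_def using assms by (intro powr_less_mono2) auto
  then have q: "0 < q" "q < 1" by (auto simp: q_def)
  have e_le: "e m \<le> q ^ m" for m
  proof -
    have "e m \<le> ((1/2) ^ m) powr (1 / \<beta>)"
      unfolding e_def using a(1)[of m] a(2)[of m] assms by (intro powr_mono2) auto
    also have "\<dots> = q ^ m"
      by (simp add: q_def powr_powr mult.commute flip: powr_realpow)
    finally show ?thesis .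
  qed
  have a_0: "a \<longlonglongrightarrow> 0"
    by (rule tendsto_sandwich[OF _ _ tendsto_const LIMSEQ_power_zero[of "1/2"]])
       (use a in \<open>auto intro!: always_eventually intro: less_imp_le\<close>)
  have e_0: "e \<longlonglongrightarrow> 0"
    by (rule tendsto_sandwich[OF _ _ tendsto_const LIMSEQ_power_zero[of q]])
       (use e_pos e_le q in \<open>auto intro!: always_eventually intro: less_imp_le\<close>)
  then have e_right: "filterlim e (at_right 0) sequentially"
    using e_pos by (auto intro!: tendsto_imp_filterlim_at_right always_eventually)
  have transient_0: "(\<lambda>m. real m * e m) \<longlonglongrightarrow> 0"
  proof (rule tendsto_sandwich[OF _ _ tendsto_const powser_times_n_limit_0[of q]])
    show "\<forall>\<^sub>F m in sequentially. real m * e m \<le> of_nat m * q ^ m"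
      using e_le by (auto intro!: always_eventually mult_left_mono)
  qed (use e_pos q in \<open>auto intro!: always_eventually mult_nonneg_nonneg intro: less_imp_le\<close>)
  let ?N = "\<lambda>m. nat \<lfloor>1 / e m\<rfloor>"
  have lower: "cos (2 * pi * a m) * (e m * real (?N m)) - 2 * (real m * e m)
                 \<le> slow_path \<beta> (e m) y0 1" for m
  proof -
    have "e m * (cos (2 * pi * a m) * real (?N m) - 2 * real m) \<le> slow_var \<beta> (e m) y0 (?N m)"
      using e_pos[of m] a(3)[of m] cos_fast_var_eq_if_dyadic[of m y0 "e m" \<beta>]
      by (intro slow_var_ge_if_eventually_cos_ge) (auto simp: e_powr)
    then show ?thesis by (simp add: slow_path_def algebra_simps)
  qed
  have "(\<lambda>m. cos (2 * pi * a m) * (e m * real (?N m)) - 2 * (real m * e m))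
          \<longlonglongrightarrow> cos (2 * pi * 0) * 1 - 2 * 0"
    by (intro tendsto_intros a_0 transient_0
          filterlim_compose[OF step_times_number_of_steps_tendsto_1 e_right])
  then have lim: "(\<lambda>m. cos (2 * pi * a m) * (e m * real (?N m)) - 2 * (real m * e m)) \<longlonglongrightarrow> 1"
    by simp
  have "(\<lambda>m. slow_path \<beta> (e m) y0 1) \<longlonglongrightarrow> 1"
    by (rule tendsto_sandwich[OF _ _ lim tendsto_const])
       (use lower slow_path_le_1[OF e_pos] in auto)
  with e_right show ?thesis by blast
qed

theorem proposition7p1:
  fixes \<beta> y0 :: real
  assumes "\<beta> > 0" and "y0 \<in> {0..1}"
  shows "Limsup (at_right (0::real)) (\<lambda>\<epsilon>. ereal (slow_path \<beta> \<epsilon> y0 1)) = 1"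
proof (rule antisym)
  have "\<forall>\<^sub>F \<epsilon> in at_right 0. ereal (slow_path \<beta> \<epsilon> y0 1) \<le> 1"
    using eventually_at_right_less[of 0] by eventually_elim (simp add: slow_path_le_1)
  then show "Limsup (at_right (0::real)) (\<lambda>\<epsilon>. ereal (slow_path \<beta> \<epsilon> y0 1)) \<le> 1"
    by (rule Limsup_bounded)
next
  obtain e where e: "filterlim e (at_right 0) sequentially"
      "(\<lambda>m. slow_path \<beta> (e m) y0 1) \<longlonglongrightarrow> 1"
    using slow_path_tendsto_1_along_dyadic_shifts[OF assms(1)] by blast
  show "1 \<le> Limsup (at_right (0::real)) (\<lambda>\<epsilon>. ereal (slow_path \<beta> \<epsilon> y0 1))"
  proof (rule ccontr)
    assume "\<not> ?thesis"
    then obtain c where c: "Limsup (at_right (0::real)) (\<lambda>\<epsilon>. ereal (slow_path \<beta> \<epsilon> y0 1)) < c" "c < 1"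
      using dense by (metis not_le)
    have "\<forall>\<^sub>F m in sequentially. ereal (slow_path \<beta> (e m) y0 1) < c"
      using eventually_compose_filterlim[OF Limsup_lessD[OF c(1)] e(1)] .
    moreover have "(\<lambda>m. ereal (slow_path \<beta> (e m) y0 1)) \<longlonglongrightarrow> 1"
      using tendsto_ereal[OF e(2)] by (simp add: one_ereal_def)
    then have "\<forall>\<^sub>F m in sequentially. c < ereal (slow_path \<beta> (e m) y0 1)"
      using c(2) by (rule order_tendstoD(1))
    ultimately have "\<forall>\<^sub>F m::nat in sequentially. False"
      by eventually_elim simp
    then show False by simp
  qed
qed

end
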